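(* Suppose that the power series $B(x,P) = \sum_{k=0}^\infty\sum_{\ell=0}^\infty b_{k,\ell}\, x^k P^\ell$ (with coefficients as defined in the context) satisfies: (i) it converges for all $0 \le x < \frac12$, $x \le P \le \frac12$; (ii) $B(x,P) \ge 0$ for all $0 \le x < \frac12$, $x \le P \le \frac12$; and (iii) $\int_0^P B(x,P)\,dx = \frac{1}{P+1} - \sqrt{\frac{1-2P}{1+2P}}$ for all $0 \le P \le \frac12$. Let $n \ge 2$, let $0 \le p_1 < p_2 < \cdots < p_n \le 1$ be the blue-fractions of $n$ bichromatic urns, and let $\epsilon = \min_{1\le i\le n-1}(p_{i+1}-p_i)$. Then there exists a symmetric voting scheme for the Condorcet election such that, for every $\eta\in(0,1)$, with $O\left(\frac{\ln \eta^{-1}}{\epsilon^2}\right)$ voters (absolute implicit constant), whichever urn is the correct one, the correct urn wins the election with probability at least $1-\eta$.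
   Context: Coefficients: for integers $k,\ell \ge 0$ let $c_{k,\ell} = (-1)^{k+\ell}\binom{k+\ell}{k} - \frac{(-1)^{\ell}\binom{k+\ell}{k} + (-1)^{k+\ell}(\ell+1)}{k+\ell+2}$. Define $b_{k,\ell}$ by $b_{k,\ell} = 0$ if $k<0$ or $\ell<0$, and for $k,\ell\ge 0$, $b_{k,\ell} = (k+1)\left(x_{k-1,\ell} + y_{k-1,\ell} - c_{k+1,\ell}\right)$, where $x_{k,\ell} = \sum_{i,j\ge 0,\ i+j\le k}\frac{b_{i,k-i-j}\, b_{j,\ell}}{(i+1)(i+j+2)}$ and $y_{k,\ell} = \sum_{i=0}^{k}(-1)^{k-i}\frac{b_{i,\ell}}{i+1}$ (empty sums are $0$; the recursion is well defined when computed in order of increasing $k+\ell$, then increasing $k$). Voting model: urn $i$ has a fraction $p_i$ of blue and $1-p_i$ of red balls. One urn is chosen (adversarially) as the correct urn; each of $m$ voters independently draws one ball (with replacement) from it and observes only its color. In a Condorcet election each voter returns a total ordering (ranking) of the $n$ urns, chosen by a possibly randomized rule depending on the observed color (independent randomness across voters); the scheme is symmetric if all voters use the same rule, and the rule may depend on $p_1,\dots,p_n$ but not on which urn is correct. Urn $i$ beats urn $j$ in a run-off if more than half of the voters rank $i$ higher than $j$; urn $i$ wins the election if it beats every other urn $j\neq i$.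
   Formalization: The number of voters is bounded by C·max(1, ln(1/η))/ε² instead of C·ln(1/η)/ε², since for η close to 1 the latter would force zero voters, and then no urn wins; for η ≤ 1/2 the two bounds agree up to a constant. *)

theory Defs
  imports "HOL-Analysis.Analysis" "HOL-Probability.Probability" "HOL-Probability.Product_PMF"
begin

definition c_coeff :: "nat \<Rightarrow> nat \<Rightarrow> real" where
  "c_coeff k l = (-1) ^ (k + l) * real ((k + l) choose k)
     - ((-1) ^ l * real ((k + l) choose k) + (-1) ^ (k + l) * (real l + 1)) / (real k + real l + 2)"

text \<open>
  The coefficients with a negative index are 0, and the sums with first index \<open>-1\<close> are empty, so
  natural-number indices suffice; \<open>b_coeff 0 l\<close> is the general formula with both sums equal to 0.
\<close>

function b_coeff :: "nat \<Rightarrow> nat \<Rightarrow> real"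
  and x_coeff :: "nat \<Rightarrow> nat \<Rightarrow> real"
  and y_coeff :: "nat \<Rightarrow> nat \<Rightarrow> real"
where
  "b_coeff 0 l = - c_coeff 1 l"
| "b_coeff (Suc k) l = (real (Suc k) + 1) * (x_coeff k l + y_coeff k l - c_coeff (Suc k + 1) l)"
| "x_coeff k l = (\<Sum>i\<in>{0..k}. \<Sum>j\<in>{0..k - i}.
      b_coeff i (k - i - j) * b_coeff j l / ((real i + 1) * (real i + real j + 2)))"
| "y_coeff k l = (\<Sum>i\<in>{0..k}. (-1) ^ (k - i) * b_coeff i l / (real i + 1))"
  by pat_completeness auto
termination
  by (relation "Wellfounded.measure (case_sum (\<lambda>(k, l). 2 * (k + l))
        (case_sum (\<lambda>(k, l). 2 * (k + l) + 1) (\<lambda>(k, l). 2 * (k + l) + 1)))") auto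

declare b_coeff.simps [simp del] x_coeff.simps [simp del] y_coeff.simps [simp del]

definition B_term :: "real \<Rightarrow> real \<Rightarrow> nat \<times> nat \<Rightarrow> real" where
  "B_term x P = (\<lambda>(k, l). b_coeff k l * x ^ k * P ^ l)"

text \<open>
  Convergence of the double power series is unconditional (equivalently, absolute) convergence,
  i.e. \<open>B_term x P summable_on UNIV\<close>.
\<close>

definition B_series :: "real \<Rightarrow> real \<Rightarrow> real" where
  "B_series x P = infsum (B_term x P) UNIV"


text \<open>
  The urns are \<open>1, \<dots>, n\<close> and the voters are \<open>0, \<dots>, m - 1\<close>. A ranking \<open>r\<close> is a total order on the
  urns, where \<open>(i, j) \<in> r\<close> means that \<open>i\<close> is ranked at least as high as \<open>j\<close>. The observed colour is
  \<open>True\<close> for blue. A scheme assigns to every voter and observed colour a distribution on rankings.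
\<close>

type_synonym ranking = "(nat \<times> nat) set"
type_synonym scheme = "nat \<Rightarrow> bool \<Rightarrow> ranking pmf"

definition voting_scheme :: "nat \<Rightarrow> scheme \<Rightarrow> bool" where
  "voting_scheme n S \<longleftrightarrow> (\<forall>v col. \<forall>r\<in>set_pmf (S v col). linear_order_on {1..n} r)"

definition symmetric_scheme :: "scheme \<Rightarrow> bool" where
  "symmetric_scheme S \<longleftrightarrow> (\<forall>v w. S v = S w)"

text \<open>The joint law of the rankings of \<open>m\<close> voters when the correct urn has blue fraction \<open>q\<close>.\<close>

definition ballots :: "nat \<Rightarrow> scheme \<Rightarrow> real \<Rightarrow> (nat \<Rightarrow> ranking) pmf" where
  "ballots m S q = Pi_pmf {..<m} {} (\<lambda>v. bind_pmf (bernoulli_pmf q) (S v))"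

definition beats :: "nat \<Rightarrow> (nat \<Rightarrow> ranking) \<Rightarrow> nat \<Rightarrow> nat \<Rightarrow> bool" where
  "beats m R i j \<longleftrightarrow> real (card {v. v < m \<and> (i, j) \<in> R v}) > real m / 2"

definition wins_election :: "nat \<Rightarrow> nat \<Rightarrow> (nat \<Rightarrow> ranking) \<Rightarrow> nat \<Rightarrow> bool" where
  "wins_election n m R i \<longleftrightarrow> (\<forall>j\<in>{1..n}. j \<noteq> i \<longrightarrow> beats m R i j)"

definition min_gap :: "nat \<Rightarrow> (nat \<Rightarrow> real) \<Rightarrow> real" where
  "min_gap n p = Min ((\<lambda>i. p (i + 1) - p i) ` {1..n - 1})"

end

theory Submission
  imports Defs "HOL-Probability.Hoeffding"
begin

text \<open>
  A voter who sees red draws a random threshold: the urns above it are ranked by increasing blue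
  fraction, those below form a block whose internal direction is a fair coin flip and which is put
  on top with probability 3/4. If urn \<open>i\<close> is above the threshold with probability \<open>g i\<close>, then urn
  \<open>i\<close> is ranked above a later urn \<open>j\<close> with probability \<open>1/2 + (g i + g j) / 4\<close>. Take
  \<open>g i = p i / max (p i) (1 - p i)\<close>, and let a voter who sees blue use the mirror image of this rule,
  with \<open>h i = (1 - p i) / max (p i) (1 - p i)\<close>. Because \<open>(1 - p i) * g i = p i * h i\<close>, the
  contributions of the correct urn cancel, and a voter ranks the correct urn \<open>i\<close> above \<open>j\<close>
  with probability at least \<open>1/2 + \<bar>p i - p j\<bar> / 4\<close>. As \<open>\<bar>p i - p j\<bar>\<close> grows linearly in \<open>\<bar>i - j\<bar>\<close>,
  the union bound over Hoeffding's inequality is a geometric series, so no factor depending on \<open>n\<close>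
  is lost.
\<close>

section \<open>Discrete distributions with prescribed distribution functions\<close>

lemma measure_bind_pmf:
  "measure_pmf.prob (bind_pmf M f) A = measure_pmf.expectation M (\<lambda>x. measure_pmf.prob (f x) A)"
  unfolding measure_pmf_bind
  by (intro measure_pmf.measure_bind[where N = "count_space UNIV"])
     (auto simp: measure_pmf_in_subprob_algebra)

lemma bool_pmf_eq_bernoulli: "D = bernoulli_pmf (pmf D True)"
proof (rule pmf_eqI)
  fix b
  have "pmf D True + pmf D False = 1"
    using sum_pmf_eq_1[of "{True, False}" D] by (auto simp: subset_iff)
  then show "pmf D b = pmf (bernoulli_pmf (pmf D True)) b"
    by (cases b) (auto simp: pmf_le_1)
qed

text \<open>The increments of \<open>g\<close> serve as point masses. The mass left over after
  \<open>n\<close> goes to the point \<open>n + 1\<close>, which as a threshold lies above every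
  urn.\<close>

lemma exists_pmf_with_cdf:
  fixes g :: "nat \<Rightarrow> real"
  assumes mono: "mono_on {1..n} g" and range: "\<And>i. i \<in> {1..n} \<Longrightarrow> 0 \<le> g i \<and> g i \<le> 1"
  shows "\<exists>D :: nat pmf. \<forall>i\<in>{1..n}. measure_pmf.prob D {..i} = g i"
proof -
  define F where "F i = (if i = 0 then 0 else if i \<le> n then g i else 1)" for i
  define f where "f i = (if i = 0 then 0 else F i - F (i - 1))" for i
  have sum_f: "(\<Sum>k\<le>i. f k) = F i" for i
    by (induction i) (auto simp: f_def F_def)
  have f_nonneg: "0 \<le> f i" for i
    using range[of i] range[of "i - 1"] mono_onD[OF mono, of "i - 1" i]
    by (auto simp: f_def F_def)
  have f_zero: "f i = 0" if "i > Suc n" for i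
    using that by (auto simp: f_def F_def)
  have "(\<integral>\<^sup>+x. ennreal (f x) \<partial>count_space UNIV) = (\<Sum>k\<le>Suc n. ennreal (f k))"
    by (rule nn_integral_count_space') (auto simp: f_zero not_le)
  also have "\<dots> = 1"
    using sum_f[of "Suc n"] by (subst sum_ennreal) (auto simp: f_nonneg F_def)
  finally have norm: "(\<integral>\<^sup>+x. ennreal (f x) \<partial>count_space UNIV) = 1" .
  have "measure_pmf.prob (embed_pmf f) {..i} = g i" if "i \<in> {1..n}" for i
    using that sum_f[of i]
    by (simp add: measure_measure_pmf_finite pmf_embed_pmf[OF f_nonneg norm] F_def)
  then show ?thesis by blast
qed

section \<open>Random rankings given by integer keys\<close>

text \<open>
  Smaller keys are ranked higher. The urns from \<open>t\<close> on are ranked in increasing order; those below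
  \<open>t\<close> form a block in increasing or decreasing order, placed at the top (\<open>up\<close>) or at the bottom.
\<close>

definition block_key :: "nat \<Rightarrow> nat \<Rightarrow> bool \<Rightarrow> bool \<Rightarrow> nat \<Rightarrow> int" where
  "block_key n t inc up i =
     (if t \<le> i then int i
      else (if inc then int i else - int i) + (if up then - (2 * int n + 1) else 2 * int n + 1))"

text \<open>The shift by \<open>2 * int n + 1\<close> keeps the block clear of the keys
  \<open>1, ..., n\<close> even when its order is reversed: its keys are negative at the top and at
  least \<open>n + 1\<close> at the bottom.\<close>

lemma inj_on_block_key: "inj_on (block_key n t inc up) {1..n}"
  by (rule inj_onI) (auto simp: block_key_def split: if_splits)

text \<open>Fix the threshold \<open>t\<close> and let \<open>i < j\<close>. Urn \<open>i\<close>
  comes first with probability 1 if \<open>t \<le> i\<close>, 3/4 if \<open>i < t \<le> j\<close>,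
  and 1/2 if \<open>j < t\<close>. As 3/4 is the mean of the other two values, the probability is
  affine in the indicators of \<open>t \<le> i\<close> and \<open>t \<le> j\<close>; averaging over
  \<open>t\<close> turns these into \<open>g i\<close> and \<open>g j\<close>.\<close>

lemma exists_key_pmf_increasing:
  fixes g :: "nat \<Rightarrow> real"
  assumes "mono_on {1..n} g" and "\<And>i. i \<in> {1..n} \<Longrightarrow> 0 \<le> g i \<and> g i \<le> 1"
  shows "\<exists>D :: (nat \<Rightarrow> int) pmf. (\<forall>f\<in>set_pmf D. inj_on f {1..n}) \<and>
           (\<forall>i\<in>{1..n}. \<forall>j\<in>{1..n}. i < j \<longrightarrow>
              measure_pmf.prob D {f. f i < f j} = 1/2 + (g i + g j) / 4)"
proof -
  obtain T :: "nat pmf" where T: "measure_pmf.prob T {..i} = g i" if "i \<in> {1..n}" for i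
    using exists_pmf_with_cdf[OF assms] by blast
  define K where "K t = bind_pmf (bernoulli_pmf (1/2)) (\<lambda>inc.
      map_pmf (\<lambda>up. block_key n t inc up) (bernoulli_pmf (3/4)))" for t
  have K: "measure_pmf.prob (K t) {f. f i < f j} =
      1/2 + (indicator {..i} t + indicator {..j} t) / 4"
    if "i \<in> {1..n}" "j \<in> {1..n}" "i < j" for i j t
  proof -
    have "measure_pmf.prob (bernoulli_pmf (3/4)) {up. block_key n t inc up i < block_key n t inc up j} =
        (if t \<le> i \<or> j < t \<and> inc then 1 else if j < t then 0 else 3/4)" for inc
    proof -
      have "{up. block_key n t inc up i < block_key n t inc up j} =
          (if t \<le> i \<or> j < t \<and> inc then UNIV else if j < t then {} else {True})"
        using that by (auto simp: block_key_def)
      then show ?thesis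
        by (auto simp: measure_pmf_single)
    qed
    then show ?thesis
      using that by (auto simp: K_def measure_bind_pmf vimage_def)
  qed
  have "measure_pmf.prob (bind_pmf T K) {f. f i < f j} = 1/2 + (g i + g j) / 4"
    if "i \<in> {1..n}" "j \<in> {1..n}" "i < j" for i j
  proof -
    have int: "integrable (measure_pmf T) (indicator A :: nat \<Rightarrow> real)" for A
      by (rule measure_pmf.integrable_const_bound[where B = 1]) (auto simp: indicator_def)
    have "measure_pmf.prob (bind_pmf T K) {f. f i < f j} =
        measure_pmf.expectation T (\<lambda>t. 1/2 + (indicator {..i} t + indicator {..j} t) / 4)"
      by (simp add: measure_bind_pmf K[OF that])
    also have "\<dots> = 1/2 + (measure_pmf.prob T {..i} + measure_pmf.prob T {..j}) / 4"
      by (simp add: int)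
    finally show ?thesis
      using that by (simp add: T)
  qed
  moreover have "\<forall>f\<in>set_pmf (bind_pmf T K). inj_on f {1..n}"
    using inj_on_block_key unfolding K_def by fastforce
  ultimately show ?thesis by blast
qed

text \<open>Renumbering urn \<open>i\<close> as \<open>n + 1 - i\<close> makes \<open>h\<close>
  monotone and reverses the order of the urns, which reduces this to the increasing case.\<close>

lemma exists_key_pmf_decreasing:
  fixes h :: "nat \<Rightarrow> real"
  assumes anti: "antimono_on {1..n} h" and range: "\<And>i. i \<in> {1..n} \<Longrightarrow> 0 \<le> h i \<and> h i \<le> 1"
  shows "\<exists>D :: (nat \<Rightarrow> int) pmf. (\<forall>f\<in>set_pmf D. inj_on f {1..n}) \<and>
           (\<forall>i\<in>{1..n}. \<forall>j\<in>{1..n}. i < j \<longrightarrow>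
              measure_pmf.prob D {f. f j < f i} = 1/2 + (h i + h j) / 4)"
proof -
  define refl where "refl i = n + 1 - i" for i
  have refl: "refl i \<in> {1..n}" "refl (refl i) = i" if "i \<in> {1..n}" for i
    using that by (auto simp: refl_def)
  have "mono_on {1..n} (h \<circ> refl)"
  proof (rule mono_onI)
    fix i j assume "i \<in> {1..n}" "j \<in> {1..n}" "i \<le> j"
    then show "(h \<circ> refl) i \<le> (h \<circ> refl) j"
      using monotone_onD[OF anti, of "refl j" "refl i"] refl by (auto simp: refl_def)
  qed
  moreover have "0 \<le> (h \<circ> refl) i \<and> (h \<circ> refl) i \<le> 1" if "i \<in> {1..n}" for i
    using range refl that by simp
  ultimately obtain D :: "(nat \<Rightarrow> int) pmf" where D: "\<forall>f\<in>set_pmf D. inj_on f {1..n}"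
    and prob: "\<And>i j. i \<in> {1..n} \<Longrightarrow> j \<in> {1..n} \<Longrightarrow> i < j \<Longrightarrow>
       measure_pmf.prob D {f. f i < f j} = 1/2 + ((h \<circ> refl) i + (h \<circ> refl) j) / 4"
    using exists_key_pmf_increasing[of n "h \<circ> refl"] by blast
  have "inj_on refl {1..n}"
    by (rule inj_onI) (auto simp: refl_def)
  moreover have "refl ` {1..n} \<subseteq> {1..n}"
    using refl by blast
  ultimately have "inj_on (f \<circ> refl) {1..n}" if "f \<in> set_pmf D" for f
    using D that by (blast intro: comp_inj_on inj_on_subset)
  moreover have "measure_pmf.prob (map_pmf (\<lambda>f. f \<circ> refl) D) {f. f j < f i} = 1/2 + (h i + h j) / 4"
    if "i \<in> {1..n}" "j \<in> {1..n}" "i < j" for i j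
    using prob[of "refl j" "refl i"] refl that by (auto simp: vimage_def refl_def add.commute)
  ultimately show ?thesis
    by (intro exI[of _ "map_pmf (\<lambda>f. f \<circ> refl) D"]) auto
qed

definition ranking_of_key :: "nat \<Rightarrow> (nat \<Rightarrow> int) \<Rightarrow> ranking" where
  "ranking_of_key n f = {(i, j). i \<in> {1..n} \<and> j \<in> {1..n} \<and> f i \<le> f j}"

lemma linear_order_ranking_of_key:
  assumes "inj_on f {1..n}"
  shows "linear_order_on {1..n} (ranking_of_key n f)"
  using inj_onD[OF assms]
  by (force simp: ranking_of_key_def linear_order_on_def partial_order_on_def preorder_on_def
      refl_on_def trans_def antisym_def total_on_def)

text \<open>Injectivity excludes ties almost surely, so the two strict comparisons are complementary
  events.\<close>

lemma prob_key_flip: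
  fixes D :: "(nat \<Rightarrow> int) pmf"
  assumes "\<forall>f\<in>set_pmf D. inj_on f {1..n}" "i \<in> {1..n}" "j \<in> {1..n}" "i \<noteq> j"
  shows "measure_pmf.prob D {f. f j < f i} = 1 - measure_pmf.prob D {f. f i < f j}"
proof -
  have neq: "f i \<noteq> f j" if "f \<in> set_pmf D" for f
    using assms that by (metis inj_on_eq_iff)
  have "measure_pmf.prob D {f. f j < f i} = measure_pmf.prob D (UNIV - {f. f i < f j})"
  proof (rule measure_pmf.finite_measure_eq_AE)
    show "AE f in D. f \<in> {f. f j < f i} \<longleftrightarrow> f \<in> UNIV - {f. f i < f j}"
      using neq by (auto simp: AE_measure_pmf_iff linorder_neq_iff)
  qed auto
  also have "\<dots> = 1 - measure_pmf.prob D {f. f i < f j}"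
    using measure_pmf.prob_compl[of "{f. f i < f j}" D] by simp
  finally show ?thesis .
qed

lemma prob_ranking_of_key:
  assumes "\<forall>f\<in>set_pmf D. inj_on f {1..n}" "i \<in> {1..n}" "j \<in> {1..n}" "i \<noteq> j"
  shows "measure_pmf.prob (map_pmf (ranking_of_key n) D) {r. (i, j) \<in> r}
         = measure_pmf.prob D {f. f i < f j}"
proof -
  have neq: "f i \<noteq> f j" if "f \<in> set_pmf D" for f
    using assms that by (metis inj_on_eq_iff)
  have "measure_pmf.prob (map_pmf (ranking_of_key n) D) {r. (i, j) \<in> r}
        = measure_pmf.prob D {f. (i, j) \<in> ranking_of_key n f}"
    by (simp add: vimage_def)
  also have "\<dots> = measure_pmf.prob D {f. f i < f j}"
    using assms(2,3)
    by (intro measure_pmf.finite_measure_eq_AE)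
       (auto simp: AE_measure_pmf_iff ranking_of_key_def less_le neq)
  finally show ?thesis .
qed

section \<open>The rule of a single voter\<close>

text \<open>The quotient is the odds \<open>x / (1 - x)\<close> capped at 1: it increases up to
  \<open>x = 1/2\<close> and is constant from there on.\<close>

lemma frac_max_mono:
  fixes x y :: real
  assumes "0 \<le> x" "x \<le> y" "y \<le> 1"
  shows "x / max x (1 - x) \<le> y / max y (1 - y)"
proof -
  have "x * max y (1 - y) \<le> y * max x (1 - x)"
  proof (cases "1 - y \<le> y")
    case True
    then show ?thesis
      using assms mult_right_mono[of x "max x (1 - x)" y]
      by (simp only: max_absorb1) (simp add: mult.commute)
  next
    case False
    then show ?thesis
      using assms by (simp add: max_def algebra_simps)
  qed
  then show ?thesis
    using assms by (simp add: frac_le_eq divide_simps max_def)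
qed

lemma exists_single_voter_rule:
  fixes p :: "nat \<Rightarrow> real"
  assumes mono: "strict_mono_on {1..n} p" and range: "\<And>i. i \<in> {1..n} \<Longrightarrow> 0 \<le> p i \<and> p i \<le> 1"
  shows "\<exists>V :: bool \<Rightarrow> ranking pmf. (\<forall>col. \<forall>r\<in>set_pmf (V col). linear_order_on {1..n} r) \<and>
    (\<forall>i\<in>{1..n}. \<forall>j\<in>{1..n}. i \<noteq> j \<longrightarrow>
       1/2 + \<bar>p i - p j\<bar> / 4 \<le> measure_pmf.prob (bind_pmf (bernoulli_pmf (p i)) V) {r. (i, j) \<in> r})"
proof -
  define w where "w i = max (p i) (1 - p i)" for i
  define g where "g i = p i / w i" for i
  define h where "h i = (1 - p i) / w i" for i
  have w: "0 < w i" "w i \<le> 1" if "i \<in> {1..n}" for i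
    using range[OF that] by (auto simp: w_def max_def)
  have p_mono: "p i \<le> p j" if "i \<in> {1..n}" "j \<in> {1..n}" "i \<le> j" for i j
    using strict_mono_onD[OF mono, of i j] that by (cases "i = j") auto
  have "mono_on {1..n} g"
    by (rule mono_onI) (auto simp: g_def w_def p_mono range intro!: frac_max_mono)
  moreover have "0 \<le> g i \<and> g i \<le> 1" if "i \<in> {1..n}" for i
    using w[OF that] range[OF that] by (auto simp: g_def w_def)
  ultimately obtain R :: "(nat \<Rightarrow> int) pmf" where R: "\<forall>f\<in>set_pmf R. inj_on f {1..n}"
    and prob_R: "\<And>i j. i \<in> {1..n} \<Longrightarrow> j \<in> {1..n} \<Longrightarrow> i < j \<Longrightarrow>
       measure_pmf.prob R {f. f i < f j} = 1/2 + (g i + g j) / 4"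
    using exists_key_pmf_increasing[of n g] by blast
  have "antimono_on {1..n} h"
  proof (rule monotone_onI)
    fix i j assume "i \<in> {1..n}" "j \<in> {1..n}" "i \<le> j"
    then show "h j \<le> h i"
      using frac_max_mono[of "1 - p j" "1 - p i"] p_mono[of i j] range
      by (simp add: h_def w_def max.commute)
  qed
  moreover have "0 \<le> h i \<and> h i \<le> 1" if "i \<in> {1..n}" for i
    using w[OF that] range[OF that] by (auto simp: h_def w_def)
  ultimately obtain B :: "(nat \<Rightarrow> int) pmf" where B: "\<forall>f\<in>set_pmf B. inj_on f {1..n}"
    and prob_B: "\<And>i j. i \<in> {1..n} \<Longrightarrow> j \<in> {1..n} \<Longrightarrow> i < j \<Longrightarrow>
       measure_pmf.prob B {f. f j < f i} = 1/2 + (h i + h j) / 4"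
    using exists_key_pmf_decreasing[of n h] by blast
  define V where "V col = map_pmf (ranking_of_key n) (if col then B else R)" for col
  have "1/2 + \<bar>p i - p j\<bar> / 4 \<le> measure_pmf.prob (bind_pmf (bernoulli_pmf (p i)) V) {r. (i, j) \<in> r}"
    if ij: "i \<in> {1..n}" "j \<in> {1..n}" "i \<noteq> j" for i j
  proof -
    \<comment> \<open>\<open>?s\<close> is the sign of \<open>p j - p i\<close>. Red leans towards
      the urn with the smaller blue fraction and blue towards the other one, hence the opposite
      signs in the two formulas below.\<close>
    let ?s = "if i < j then 1 else -1 :: real"
    have "measure_pmf.prob R {f. f i < f j} = 1/2 + ?s * (g i + g j) / 4"
      using prob_R[of i j] prob_R[of j i] prob_key_flip[OF R, of j i] ij
      by (cases "i < j") (auto simp: field_simps)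
    moreover have "measure_pmf.prob B {f. f i < f j} = 1/2 - ?s * (h i + h j) / 4"
      using prob_B[of i j] prob_B[of j i] prob_key_flip[OF B, of j i] ij
      by (cases "i < j") (auto simp: field_simps)
    ultimately have "measure_pmf.prob (bind_pmf (bernoulli_pmf (p i)) V) {r. (i, j) \<in> r}
        = (1/2 - ?s * (h i + h j) / 4) * p i + (1/2 + ?s * (g i + g j) / 4) * (1 - p i)"
      using range[OF ij(1)] R B ij
      by (simp add: measure_bind_pmf V_def prob_ranking_of_key del: measure_map_pmf)
    also have "\<dots> = 1/2 + ?s * (((1 - p i) * g i - p i * h i) + ((1 - p i) * g j - p i * h j)) / 4"
      by (simp add: field_simps)
    also have "(1 - p i) * g i - p i * h i = 0"
      by (simp add: g_def h_def)
    \<comment> \<open>The products \<open>p i * p j\<close> cancel in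
      \<open>(1 - p i) * p j - p i * (1 - p j)\<close>.\<close>
    also have "(1 - p i) * g j - p i * h j = (p j - p i) / w j"
      using w[OF ij(2)] by (simp add: g_def h_def field_simps)
    also have "1/2 + ?s * (0 + (p j - p i) / w j) / 4 = 1/2 + (\<bar>p i - p j\<bar> / w j) / 4"
      using p_mono[of i j] p_mono[of j i] ij by auto
    \<comment> \<open>Dividing by \<open>w j \<le> 1\<close> can only enlarge the advantage.\<close>
    also have "\<dots> \<ge> 1/2 + \<bar>p i - p j\<bar> / 4"
      using w[OF ij(2)] by (simp add: pos_le_divide_eq mult_left_le)
    finally show ?thesis .
  qed
  moreover have "\<forall>col. \<forall>r\<in>set_pmf (V col). linear_order_on {1..n} r"
    using R B by (auto simp: V_def simp del: One_nat_def intro!: linear_order_ranking_of_key)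
  ultimately show ?thesis by blast
qed

section \<open>A single run-off\<close>

text \<open>The number of voters who prefer \<open>i\<close> to \<open>j\<close> is binomial with
  success probability \<open>\<theta> \<ge> 1/2 + \<delta>\<close>. Losing the run-off means a count
  of at most \<open>m / 2\<close>, hence a frequency at least \<open>\<delta>\<close> below its
  mean, and Hoeffding's lower tail bound applies.\<close>

lemma prob_not_beats_le:
  fixes D :: "ranking pmf"
  assumes "m > 0" "\<delta> \<ge> 0" and \<delta>: "1/2 + \<delta> \<le> measure_pmf.prob D {r. (i, j) \<in> r}"
  shows "measure_pmf.prob (Pi_pmf {..<m} {} (\<lambda>_. D)) {R. \<not> beats m R i j} \<le> exp (- 2 * real m * \<delta>\<^sup>2)"
proof -
  define \<theta> where "\<theta> = measure_pmf.prob D {r. (i, j) \<in> r}"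
  interpret binomial_distribution m \<theta>
    by standard (auto simp: \<theta>_def)
  have "map_pmf (\<lambda>r. (i, j) \<in> r) D = bernoulli_pmf \<theta>"
    using bool_pmf_eq_bernoulli[of "map_pmf (\<lambda>r. (i, j) \<in> r) D"]
    by (simp add: \<theta>_def pmf_map vimage_def)
  then have "binomial_pmf m \<theta> = map_pmf (\<lambda>f. card {v \<in> {..<m}. f v})
      (Pi_pmf {..<m} False (\<lambda>_. map_pmf (\<lambda>r. (i, j) \<in> r) D))"
    using p by (simp add: binomial_pmf_altdef'[where A = "{..<m}" and dflt = False])
  \<comment> \<open>The default ballot \<open>{}\<close> contains no pair, so it is mapped to the
    default \<open>False\<close>, as \<open>Pi_pmf_map\<close> requires.\<close>
  also have "\<dots> = map_pmf (\<lambda>R. card {v. v < m \<and> (i, j) \<in> R v}) (Pi_pmf {..<m} {} (\<lambda>_. D))"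
    by (subst Pi_pmf_map[where dflt = "{}"]) (auto simp: pmf.map_comp o_def)
  finally have binom: "binomial_pmf m \<theta> = \<dots>" .
  have "measure_pmf.prob (Pi_pmf {..<m} {} (\<lambda>_. D)) {R. \<not> beats m R i j}
        = measure_pmf.prob (binomial_pmf m \<theta>) {x. real x \<le> real m / 2}"
    by (simp add: binom vimage_def beats_def not_less)
  also have "\<dots> \<le> measure_pmf.prob (binomial_pmf m \<theta>) {x. real x / real m \<le> \<theta> - \<delta>}"
  proof (rule measure_pmf.finite_measure_mono)
    have "real m / 2 \<le> (\<theta> - \<delta>) * real m"
      using \<delta> mult_right_mono[of "1/2" "\<theta> - \<delta>" "real m"] by (simp add: \<theta>_def)
    then show "{x. real x \<le> real m / 2} \<subseteq> {x. real x / real m \<le> \<theta> - \<delta>}"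
      using \<open>m > 0\<close> by (auto simp only: pos_divide_le_eq of_nat_0_less_iff mem_Collect_eq)
  qed simp
  also have "\<dots> \<le> exp (- 2 * real m * \<delta>\<^sup>2)"
    using prob_le'[of \<delta>] assms by simp
  finally show ?thesis .
qed

section \<open>The union bound over all opponents\<close>

text \<open>Distinct positive exponents select part of the geometric series without its constant
  term; adding the exponent 0 allows comparison with the full series.\<close>

lemma sum_powers_le:
  fixes r :: real and d :: "'a \<Rightarrow> nat"
  assumes "0 \<le> r" "r < 1" "finite A" "inj_on d A" "0 \<notin> d ` A"
  shows "(\<Sum>a\<in>A. r ^ d a) \<le> r / (1 - r)"
proof -
  have "1 + (\<Sum>a\<in>A. r ^ d a) = (\<Sum>k\<in>insert 0 (d ` A). r ^ k)"
    using assms by (simp add: sum.reindex)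
  also have "\<dots> \<le> (\<Sum>k. r ^ k)"
    using assms by (intro sum_le_suminf) (auto simp: summable_geometric)
  also have "\<dots> = 1 + r / (1 - r)"
    using assms by (simp add: suminf_geometric field_simps)
  finally show ?thesis by simp
qed

text \<open>On either side of \<open>i\<close> the distances to \<open>i\<close> are distinct and
  positive, so each side contributes at most one geometric tail.\<close>

lemma sum_powers_dist_le:
  fixes r :: real
  assumes "0 \<le> r" "r < 1" "i \<in> {1..n}"
  shows "(\<Sum>j\<in>{1..n} - {i}. r ^ nat \<bar>int i - int j\<bar>) \<le> 2 * (r / (1 - r))"
proof -
  let ?d = "\<lambda>j. nat \<bar>int i - int j\<bar>"
  have "{1..n} - {i} = {1..<i} \<union> {i<..n}"
    using assms by auto
  also have "(\<Sum>j\<in>{1..<i} \<union> {i<..n}. r ^ ?d j) =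
      (\<Sum>j\<in>{1..<i}. r ^ ?d j) + (\<Sum>j\<in>{i<..n}. r ^ ?d j)"
    by (rule sum.union_disjoint) auto
  also have "(\<Sum>j\<in>{1..<i}. r ^ ?d j) \<le> r / (1 - r)"
    using assms by (intro sum_powers_le) (auto simp: inj_on_def)
  also have "(\<Sum>j\<in>{i<..n}. r ^ ?d j) \<le> r / (1 - r)"
    using assms by (intro sum_powers_le) (auto simp: inj_on_def)
  finally show ?thesis by simp
qed

lemma min_gap_mult_le:
  assumes "i \<in> {1..n}" "j \<in> {1..n}" "i \<le> j"
  shows "real (j - i) * min_gap n p \<le> p j - p i"
  using \<open>i \<le> j\<close> \<open>j \<in> {1..n}\<close>
proof (induction j rule: dec_induct)
  case (step k)
  have "min_gap n p \<le> p (k + 1) - p k"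
    unfolding min_gap_def using step assms by (intro Min_le) auto
  moreover have "k \<in> {1..n}"
    using step assms by auto
  ultimately show ?case
    using step by (auto simp: algebra_simps Suc_diff_le)
qed simp

lemma min_gap_dist_le:
  assumes "i \<in> {1..n}" "j \<in> {1..n}"
  shows "real (nat \<bar>int i - int j\<bar>) * min_gap n p \<le> \<bar>p i - p j\<bar>"
proof (cases "i \<le> j")
  case True
  then have "nat \<bar>int i - int j\<bar> = j - i" by simp
  then show ?thesis
    using min_gap_mult_le[OF assms True, of p] by simp
next
  case False
  then have "nat \<bar>int i - int j\<bar> = i - j" "j \<le> i" by simp_all
  then show ?thesis
    using min_gap_mult_le[OF assms(2,1), of p] by simp
qed

lemma min_gap_pos:
  assumes "2 \<le> n" "strict_mono_on {1..n} p"
  shows "0 < min_gap n p"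
proof -
  have "0 < p (i + 1) - p i" if "i \<in> {1..n - 1}" for i
    using strict_mono_onD[OF assms(2), of i "i + 1"] that by auto
  with assms(1) show ?thesis
    unfolding min_gap_def by (subst Min_gr_iff) auto
qed

text \<open>An opponent at index distance \<open>k\<close> has a blue fraction differing by at least
  \<open>k * min_gap n p\<close>, so the run-off against it is lost with probability at most
  \<open>r ^ k\<close>. Summing over the opponents gives a bound free of \<open>n\<close>. The 8 in
  \<open>r\<close> comes from \<open>2 * (1/4)\<^sup>2 = 1/8\<close>.\<close>

lemma prob_wins_election_ge:
  fixes p :: "nat \<Rightarrow> real" and D :: "ranking pmf"
  assumes "m > 0" "i \<in> {1..n}" and gap: "0 < min_gap n p"
    and D: "\<And>j. j \<in> {1..n} \<Longrightarrow> j \<noteq> i \<Longrightarrow>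
      1/2 + \<bar>p i - p j\<bar> / 4 \<le> measure_pmf.prob D {r. (i, j) \<in> r}"
  defines "r \<equiv> exp (- real m * (min_gap n p)\<^sup>2 / 8)"
  shows "1 - 2 * (r / (1 - r)) \<le>
    measure_pmf.prob (Pi_pmf {..<m} {} (\<lambda>_. D)) {R. wins_election n m R i}"
proof -
  let ?\<epsilon> = "min_gap n p" and ?M = "Pi_pmf {..<m} {} (\<lambda>_. D)"
  have r: "0 \<le> r" "r < 1"
    using assms by (auto simp: r_def)
  have single: "measure_pmf.prob ?M {R. \<not> beats m R i j} \<le> r ^ nat \<bar>int i - int j\<bar>"
    if j: "j \<in> {1..n} - {i}" for j
  proof -
    define k where "k = nat \<bar>int i - int j\<bar>"
    have "k \<ge> 1"
      using j by (auto simp: k_def)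
    \<comment> \<open>Weakening \<open>k\<^sup>2\<close> to \<open>k\<close> makes the exponent
      linear in the distance, which is what a geometric series needs.\<close>
    have "real k * ?\<epsilon>\<^sup>2 \<le> (real k)\<^sup>2 * ?\<epsilon>\<^sup>2"
      using \<open>k \<ge> 1\<close> by (intro mult_right_mono) (auto simp: power2_eq_square)
    also have "\<dots> = (real k * ?\<epsilon>)\<^sup>2"
      by (simp add: power_mult_distrib)
    also have "\<dots> \<le> \<bar>p i - p j\<bar>\<^sup>2"
      using min_gap_dist_le[of i n j p] assms j by (intro power_mono) (auto simp: k_def)
    finally have *: "real m * (real k * ?\<epsilon>\<^sup>2) \<le> real m * \<bar>p i - p j\<bar>\<^sup>2"
      by (intro mult_left_mono) auto
    have "measure_pmf.prob ?M {R. \<not> beats m R i j} \<le> exp (- 2 * real m * (\<bar>p i - p j\<bar> / 4)\<^sup>2)"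
      using D[of j] j assms by (intro prob_not_beats_le) auto
    also have "\<dots> \<le> exp (real k * (- real m * ?\<epsilon>\<^sup>2 / 8))"
      using * by (simp add: power_divide algebra_simps)
    also have "\<dots> = r ^ k"
      unfolding r_def by (rule exp_of_nat_mult)
    finally show ?thesis by (simp add: k_def)
  qed
  have "1 - measure_pmf.prob ?M {R. wins_election n m R i} =
      measure_pmf.prob ?M (UNIV - {R. wins_election n m R i})"
    using measure_pmf.prob_compl[of "{R. wins_election n m R i}" ?M] by simp
  also have "UNIV - {R. wins_election n m R i} = (\<Union>j\<in>{1..n} - {i}. {R. \<not> beats m R i j})"
    by (auto simp: wins_election_def)
  also have "measure_pmf.prob ?M \<dots> \<le> (\<Sum>j\<in>{1..n} - {i}. measure_pmf.prob ?M {R. \<not> beats m R i j})"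
    by (intro measure_pmf.finite_measure_subadditive_finite) auto
  also have "\<dots> \<le> (\<Sum>j\<in>{1..n} - {i}. r ^ nat \<bar>int i - int j\<bar>)"
    by (intro sum_mono single)
  also have "\<dots> \<le> 2 * (r / (1 - r))"
    using r assms by (intro sum_powers_dist_le)
  finally show ?thesis by simp
qed

section \<open>The number of voters and the conclusion\<close>

text \<open>\<open>m\<close> is chosen so that \<open>r \<le> \<eta> / 4\<close>. The constant is
  \<open>33 = 8 * (3 + 1) + 1\<close>: 3 bounds \<open>ln 4\<close>, the inner 1 is the coefficient
  of \<open>L\<close>, and the last 1 pays for rounding up, since
  \<open>1 \<le> 1 / \<epsilon>\<^sup>2\<close>. The \<open>max 1\<close> absorbs the constant terms
  when \<open>\<eta>\<close> is close to 1.\<close>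

lemma exists_number_of_voters:
  fixes \<epsilon> \<eta> :: real
  assumes "0 < \<epsilon>" "\<epsilon> \<le> 1" "0 < \<eta>" "\<eta> < 1"
  shows "\<exists>m::nat. m > 0 \<and> real m \<le> 33 * (max 1 (ln (1 / \<eta>)) / \<epsilon>\<^sup>2) \<and>
    2 * (exp (- real m * \<epsilon>\<^sup>2 / 8) / (1 - exp (- real m * \<epsilon>\<^sup>2 / 8))) \<le> \<eta>"
proof -
  define L where "L = ln (1 / \<eta>)"
  define m where "m = nat \<lceil>8 * ln (4 / \<eta>) / \<epsilon>\<^sup>2\<rceil>"
  define r where "r = exp (- real m * \<epsilon>\<^sup>2 / 8)"
  have ln4: "ln (4 / \<eta>) = ln 4 + L"
    using assms by (simp add: L_def ln_div)
  have "ln 4 \<le> (3::real)"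
    using ln_le_minus_one[of 4] by simp
  have pos: "0 < 8 * ln (4 / \<eta>) / \<epsilon>\<^sup>2"
    using assms by simp
  have lower: "8 * ln (4 / \<eta>) / \<epsilon>\<^sup>2 \<le> real m"
    using pos by (simp add: m_def)
  have "real m \<le> 8 * ln (4 / \<eta>) / \<epsilon>\<^sup>2 + 1"
    using pos unfolding m_def by linarith
  also have "1 \<le> 1 / \<epsilon>\<^sup>2"
    using assms by (simp add: power_le_one)
  also have "8 * ln (4 / \<eta>) / \<epsilon>\<^sup>2 + 1 / \<epsilon>\<^sup>2 = (8 * (ln 4 + L) + 1) / \<epsilon>\<^sup>2"
    by (simp add: ln4 add_divide_distrib)
  also have "\<dots> \<le> (33 * max 1 L) / \<epsilon>\<^sup>2"
    using \<open>ln 4 \<le> 3\<close> by (intro divide_right_mono) auto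
  finally have upper: "real m \<le> 33 * (max 1 L / \<epsilon>\<^sup>2)"
    by simp
  have "- real m * \<epsilon>\<^sup>2 / 8 \<le> - ln (4 / \<eta>)"
    using lower assms by (simp add: field_simps)
  then have "r \<le> exp (- ln (4 / \<eta>))"
    by (simp add: r_def)
  also have "\<dots> = \<eta> / 4"
    using assms by (simp add: exp_minus)
  finally have "r \<le> \<eta> / 4" .
  moreover have "\<eta> * r \<le> r"
    using assms by (simp add: r_def)
  \<comment> \<open>Clearing the denominator leaves \<open>2 * r + \<eta> * r \<le> \<eta>\<close>,
    and the left side is at most \<open>3 * r \<le> 3 * \<eta> / 4\<close>.\<close>
  ultimately have "2 * (r / (1 - r)) \<le> \<eta>"
    using assms by (simp add: field_simps)
  moreover have "m > 0"
    using lower pos by (metis less_le_trans of_nat_0_less_iff)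
  ultimately show ?thesis
    using upper by (auto simp: r_def L_def)
qed

theorem theorem8:
  assumes converges: "\<And>x P :: real. 0 \<le> x \<Longrightarrow> x < 1/2 \<Longrightarrow> x \<le> P \<Longrightarrow> P \<le> 1/2
      \<Longrightarrow> B_term x P summable_on UNIV"
    and nonneg: "\<And>x P :: real. 0 \<le> x \<Longrightarrow> x < 1/2 \<Longrightarrow> x \<le> P \<Longrightarrow> P \<le> 1/2 \<Longrightarrow> 0 \<le> B_series x P"
    and integral: "\<And>P :: real. 0 \<le> P \<Longrightarrow> P \<le> 1/2
      \<Longrightarrow> ((\<lambda>x. B_series x P) has_integral (1 / (P + 1) - sqrt ((1 - 2*P) / (1 + 2*P)))) {0..P}"
  shows "\<exists>C > 0 :: real. \<forall>(n :: nat) (p :: nat \<Rightarrow> real).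
      2 \<le> n \<longrightarrow> 0 \<le> p 1 \<longrightarrow> strict_mono_on {1..n} p \<longrightarrow> p n \<le> 1 \<longrightarrow>
      (\<exists>S. voting_scheme n S \<and> symmetric_scheme S \<and>
        (\<forall>\<eta> :: real. 0 < \<eta> \<longrightarrow> \<eta> < 1 \<longrightarrow>
          (\<exists>m :: nat. real m \<le> C * (max 1 (ln (1 / \<eta>)) / (min_gap n p)\<^sup>2) \<and>
            (\<forall>i\<in>{1..n}.
              measure_pmf.prob (ballots m S (p i)) {R. wins_election n m R i} \<ge> 1 - \<eta>))))"
proof (intro exI[of _ "33::real"] conjI allI impI)
  fix n :: nat and p :: "nat \<Rightarrow> real"
  assume n: "2 \<le> n" and p1: "0 \<le> p 1" and mono: "strict_mono_on {1..n} p" and pn: "p n \<le> 1"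
  have p_mono: "p i \<le> p j" if "i \<in> {1..n}" "j \<in> {1..n}" "i \<le> j" for i j
    using strict_mono_onD[OF mono, of i j] that by (cases "i = j") auto
  have range: "0 \<le> p i \<and> p i \<le> 1" if "i \<in> {1..n}" for i
    using p_mono[of 1 i] p_mono[of i n] that n p1 pn by auto
  \<comment> \<open>The upper bound comes from the first two urns, whose fractions both lie in the
    unit interval.\<close>
  have gap: "0 < min_gap n p" "min_gap n p \<le> 1"
    using min_gap_pos[OF n mono] min_gap_mult_le[of 1 n 2 p] range[of 1] range[of 2] n by auto
  obtain V :: "bool \<Rightarrow> ranking pmf"
    where V: "\<forall>col. \<forall>r\<in>set_pmf (V col). linear_order_on {1..n} r"
      and adv: "\<And>i j. i \<in> {1..n} \<Longrightarrow> j \<in> {1..n} \<Longrightarrow> i \<noteq> j \<Longrightarrow> 1/2 + \<bar>p i - p j\<bar> / 4 \<le>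
        measure_pmf.prob (bind_pmf (bernoulli_pmf (p i)) V) {r. (i, j) \<in> r}"
    using exists_single_voter_rule[OF mono range] by blast
  show "\<exists>S. voting_scheme n S \<and> symmetric_scheme S \<and>
        (\<forall>\<eta> :: real. 0 < \<eta> \<longrightarrow> \<eta> < 1 \<longrightarrow>
          (\<exists>m :: nat. real m \<le> 33 * (max 1 (ln (1 / \<eta>)) / (min_gap n p)\<^sup>2) \<and>
            (\<forall>i\<in>{1..n}.
              measure_pmf.prob (ballots m S (p i)) {R. wins_election n m R i} \<ge> 1 - \<eta>)))"
  \<comment> \<open>\<open>V\<close> was built from \<open>n\<close> and \<open>p\<close> alone, so
    one scheme serves every \<open>\<eta>\<close>; only \<open>m\<close> varies.\<close>
  proof (intro exI[of _ "\<lambda>_. V"] conjI allI impI)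
    show "voting_scheme n (\<lambda>_. V)" "symmetric_scheme (\<lambda>_. V)"
      using V by (auto simp: voting_scheme_def symmetric_scheme_def)
    fix \<eta> :: real assume "0 < \<eta>" "\<eta> < 1"
    then obtain m :: nat where m: "m > 0" "real m \<le> 33 * (max 1 (ln (1 / \<eta>)) / (min_gap n p)\<^sup>2)"
      "2 * (exp (- real m * (min_gap n p)\<^sup>2 / 8) / (1 - exp (- real m * (min_gap n p)\<^sup>2 / 8))) \<le> \<eta>"
      using exists_number_of_voters[OF gap] by blast
    have "1 - \<eta> \<le> measure_pmf.prob (ballots m (\<lambda>_. V) (p i)) {R. wins_election n m R i}"
      if "i \<in> {1..n}" for i
    proof -
      let ?D = "bind_pmf (bernoulli_pmf (p i)) V"
      have "1/2 + \<bar>p i - p j\<bar> / 4 \<le> measure_pmf.prob ?D {r. (i, j) \<in> r}"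
        if "j \<in> {1..n}" "j \<noteq> i" for j
        using adv[of i j] that \<open>i \<in> {1..n}\<close> by blast
      from prob_wins_election_ge[OF m(1) that gap(1) this] m(3) show ?thesis
        unfolding ballots_def by linarith
    qed
    with m show "\<exists>m :: nat. real m \<le> 33 * (max 1 (ln (1 / \<eta>)) / (min_gap n p)\<^sup>2) \<and>
        (\<forall>i\<in>{1..n}. measure_pmf.prob (ballots m (\<lambda>_. V) (p i)) {R. wins_election n m R i} \<ge> 1 - \<eta>)"
      by blast
  qed
qed simp

end
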